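(* Let $k \ge 3$ and $r\ge 3$ be fixed integers, and assume that $k-2$ is divisible by $r-2$. If $n\to\infty$, then $$f(n,k,r)\le \frac{2(r-2)^{r-2}}{r(k-2)^{r-2}} \, \binom{n}{r-1} +o(n^{r-1}) .$$
   Context: A $k$-partition of a finite set $X$ is a partition $\mathcal{P}=(X_1,\dots,X_k)$ of $X$ into precisely $k$ nonempty classes. An $r$-element set $H\subseteq X$ crosses $\mathcal{P}$ if $H$ intersects exactly $\min(r,k)$ of the classes. A hypergraph (set of subsets of $X$) crosses $\mathcal{P}$ if at least one of its members does. For integers $n\ge k$, $n\ge r$, $f(n,k,r)$ denotes the minimum number of edges of an $r$-uniform hypergraph $\mathcal{H}\subseteq\binom{X}{r}$ on an $n$-element set $X$ that crosses every $k$-partition of $X$. *)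

theory Defs
  imports Complex_Main "HOL-Library.Disjoint_Sets" "HOL-Library.Landau_Symbols"
begin

(* Partitions are unordered sets of classes; crossing does not depend on an order of the classes. *)
definition k_partition :: "nat \<Rightarrow> 'a set \<Rightarrow> 'a set set \<Rightarrow> bool" where
  "k_partition k X P \<longleftrightarrow> finite X \<and> partition_on X P \<and> card P = k"

definition set_crosses :: "'a set \<Rightarrow> 'a set set \<Rightarrow> bool" where
  "set_crosses E P \<longleftrightarrow> card {C \<in> P. E \<inter> C \<noteq> {}} = min (card E) (card P)"

definition crosses :: "'a set set \<Rightarrow> 'a set set \<Rightarrow> bool" where
  "crosses H P \<longleftrightarrow> (\<exists>E\<in>H. set_crosses E P)"

definition uniform_hypergraph :: "nat \<Rightarrow> 'a set \<Rightarrow> 'a set set \<Rightarrow> bool" where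
  "uniform_hypergraph r X H \<longleftrightarrow> H \<subseteq> {E. E \<subseteq> X \<and> card E = r}"

definition crossing_hypergraph :: "nat \<Rightarrow> nat \<Rightarrow> 'a set \<Rightarrow> 'a set set \<Rightarrow> bool" where
  "crossing_hypergraph k r X H \<longleftrightarrow>
     uniform_hypergraph r X H \<and> (\<forall>P. k_partition k X P \<longrightarrow> crosses H P)"

(* The minimum is only meaningful for k \<le> n and r \<le> n, where it is attained
   (lemma complete_crossing_hypergraph below). *)
definition min_crossing :: "nat \<Rightarrow> nat \<Rightarrow> nat \<Rightarrow> nat" where
  "min_crossing n k r = (LEAST m. \<exists>H. crossing_hypergraph k r {..<n} H \<and> card H = m)"

lemma complete_crossing_hypergraph:
  assumes "finite X" "r \<le> card X"
  shows "crossing_hypergraph k r X {E. E \<subseteq> X \<and> card E = r}"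
  unfolding crossing_hypergraph_def uniform_hypergraph_def
proof (intro conjI allI impI)
  show "{E. E \<subseteq> X \<and> card E = r} \<subseteq> {E. E \<subseteq> X \<and> card E = r}" by simp
  fix P assume "k_partition k X P"
  then have P: "partition_on X P" "card P = k" by (auto simp: k_partition_def)
  have finP: "finite P" by (rule finite_elements[OF assms(1) P(1)])
  obtain Q where Q: "Q \<subseteq> P" "card Q = min r k"
    using obtain_subset_with_card_n[of "min r k" P] P(2) by auto
  have finQ: "finite Q" using Q(1) finP finite_subset by blast
  define t where "t C = (SOME x. x \<in> C)" for C :: "'a set"
  have t: "t C \<in> C" if "C \<in> P" for C
  proof -
    have "C \<noteq> {}" using P(1) that by (auto simp: partition_on_def)
    then show ?thesis unfolding t_def using some_in_eq by blast
  qed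
  have inj: "inj_on t Q"
  proof (rule inj_onI)
    fix C D assume CD: "C \<in> Q" "D \<in> Q" "t C = t D"
    then have "t C \<in> C \<inter> D" using t[of C] t[of D] Q(1) by auto
    then show "C = D" using P(1) CD Q(1) by (auto simp: partition_on_def disjoint_def)
  qed
  have tX: "t ` Q \<subseteq> X" using t Q(1) P(1) by (auto simp: partition_on_def)
  have ct: "card (t ` Q) = min r k" using inj Q(2) by (simp add: card_image)
  obtain E where E: "t ` Q \<subseteq> E" "E \<subseteq> X" "card E = r"
    using exists_subset_between[of "t ` Q" r X] ct tX assms by auto
  have finE: "finite E" using E(2) assms(1) finite_subset by blast
  let ?M = "{C \<in> P. E \<inter> C \<noteq> {}}"
  have finM: "finite ?M" using finP by simp
  have "Q \<subseteq> ?M" using t Q(1) E(1) by blast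
  then have ge: "min r k \<le> card ?M" using card_mono[OF finM, of Q] Q(2) by simp
  have le_k: "card ?M \<le> k" using card_mono[OF finP, of ?M] P(2) by auto
  define s where "s C = (SOME x. x \<in> E \<inter> C)" for C
  have s: "s C \<in> E \<inter> C" if "C \<in> ?M" for C
  proof -
    have "E \<inter> C \<noteq> {}" using that by simp
    then show ?thesis unfolding s_def using some_in_eq by blast
  qed
  have "inj_on s ?M"
  proof (rule inj_onI)
    fix C D assume CD: "C \<in> ?M" "D \<in> ?M" "s C = s D"
    then have "s C \<in> C \<inter> D" using s[of C] s[of D] by simp
    then show "C = D" using P(1) CD by (auto simp: partition_on_def disjoint_def)
  qed
  moreover have "s ` ?M \<subseteq> E" using s by blast
  ultimately have "card ?M \<le> r" using card_inj_on_le[of s ?M E] finE E(3) by simp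
  then have "set_crosses E P" unfolding set_crosses_def using ge le_k E(3) P(2) by simp
  then show "crosses {E. E \<subseteq> X \<and> card E = r} P"
    unfolding crosses_def using E by blast
qed

end

theory Submission
  imports Defs "HOL-Number_Theory.Cong"
begin

text \<open>
  View a partition as a colouring. Since \<open>r - 2\<close> divides \<open>k - 2 > 0\<close>, we have \<open>r \<le> k\<close>, so a set of
  size \<open>r\<close> crosses the partition iff it is rainbow, that is, iff the colouring is injective on it.

  The heart of the matter is \<open>k = r\<close>. A hypergraph that meets all \<open>r\<close>-colourings must make the link
  graph of every \<open>(r - 2)\<close>-set connected, so an \<open>(r - 1)\<close>-set must on average lie in about two edges.
  In the cyclic group of order \<open>m\<close> the \<open>r\<close>-sets with sum \<open>0\<close> or \<open>1\<close> achieve this: an \<open>(r - 1)\<close>-set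
  is completed by at most two elements, which gives at most \<open>2 / r * (m choose (r - 1))\<close> edges. To
  these one adds the \<open>r\<close>-sets that contain some \<open>{0, y, y + 1}\<close>; there are only \<open>O(m ^ (r - 2))\<close> of
  them. The result has a rainbow edge for every colouring with at least \<open>r\<close> colours
  (\<open>rainbow_edge\<close>). After merging there are exactly \<open>r\<close> of them. Let \<open>a j\<close> be the largest element of
  each colour \<open>j\<close> other than the colour of \<open>0\<close>, and let \<open>w\<close> be minus the sum of all \<open>a j\<close>. If \<open>w\<close> has
  the colour of \<open>0\<close>, then \<open>w\<close> and the \<open>a j\<close> form a rainbow edge of sum \<open>0\<close>. Otherwise \<open>w\<close> has one
  of the other colours \<open>j\<close> and can replace \<open>a j\<close>. The new sum is \<open>- a j\<close>, and adding
  \<open>y = a j + 1\<close> gives an edge of sum \<open>1\<close>, which is rainbow provided that \<open>y\<close> has the colour of \<open>0\<close>.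
  If it has not, then, as \<open>a j\<close> is the largest element of its colour, \<open>0\<close>, \<open>a j\<close> and \<open>a j + 1\<close> have
  three different colours, and they extend to a rainbow edge of the second kind.

  For general \<open>k = q * (r - 2) + 2\<close>, cover the \<open>n\<close> points by \<open>q\<close> sets of about \<open>n / q\<close> points that
  all contain the point \<open>0\<close>, and put the hypergraph above on each of them. If none of them saw \<open>r\<close>
  colours, then each would see at most \<open>r - 2\<close> colours besides that of \<open>0\<close>, and the total would be
  at most \<open>1 + q * (r - 2) < k\<close> (\<open>some_part_sees_many_colours\<close>). The number of edges is about
  \<open>q * 2 / r * (n / q choose (r - 1))\<close>, and \<open>q * (1 / q) ^ (r - 1) = 1 / q ^ (r - 2)\<close> is the factor
  in the claim.
\<close>

section \<open>Rainbow edges in a cyclic group\<close>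

definition zero_or_one_sum_sets :: "nat \<Rightarrow> nat \<Rightarrow> nat set set" where
  "zero_or_one_sum_sets r m = {E. E \<subseteq> {..<m} \<and> card E = r \<and> \<Sum>E mod m \<in> {0, 1}}"

definition zero_and_consecutive_sets :: "nat \<Rightarrow> nat \<Rightarrow> nat set set" where
  "zero_and_consecutive_sets r m =
     (\<Union>y\<in>{1..<m}. {E. {0, y, Suc y} \<subseteq> E \<and> E \<subseteq> {..<m} \<and> card E = r})"

text \<open>
  An \<open>(r - 1)\<close>-set together with a residue determines the element that completes it to a set whose
  sum has this residue; hence an \<open>(r - 1)\<close>-set lies in at most one edge for each permitted sum.
\<close>
lemma completion_to_residue_unique:
  fixes E E' :: "nat set"
  assumes "E \<subseteq> {..<m}" "E' \<subseteq> {..<m}" "x \<in> E" "x' \<in> E'"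
    and F: "E - {x} = E' - {x'}" and S: "\<Sum>E mod m = \<Sum>E' mod m"
  shows "E = E' \<and> x = x'"
proof -
  have fin: "finite E" "finite E'" using assms(1,2) finite_subset by blast+
  have "\<Sum>E = x + \<Sum>(E - {x})" "\<Sum>E' = x' + \<Sum>(E' - {x'})"
    using fin assms(3,4) by (simp_all add: sum.remove)
  then have "(x + \<Sum>(E - {x})) mod m = (x' + \<Sum>(E - {x})) mod m" using S F by simp
  then have "x mod m = x' mod m"
    using cong_add_rcancel_nat[of x _ x' m] by (simp only: cong_def)
  moreover have "x < m" "x' < m" using assms(1-4) by auto
  ultimately have "x = x'" by simp
  moreover have "E = insert x (E - {x})" "E' = insert x' (E' - {x'})" using assms(3,4) by auto
  ultimately show ?thesis using F by metis
qed

text \<open>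
  Count the pairs of an edge and one of its elements. Removing the element and remembering the sum
  of the edge is injective.
\<close>
lemma card_zero_or_one_sum_sets:
  assumes "r \<ge> 1"
  shows "r * card (zero_or_one_sum_sets r m) \<le> 2 * (m choose (r - 1))"
proof -
  let ?H = "zero_or_one_sum_sets r m"
  let ?T = "{F. F \<subseteq> {..<m} \<and> card F = r - 1} \<times> {0, 1::nat}"
  let ?f = "\<lambda>(E, x). (E - {x}, \<Sum>E mod m)"
  have H: "E \<subseteq> {..<m}" "finite E" "card E = r" "\<Sum>E mod m \<in> {0, 1}" if "E \<in> ?H" for E
    using that finite_subset[of E "{..<m}"] by (auto simp: zero_or_one_sum_sets_def)
  have "finite ?H" by (rule finite_subset[of _ "Pow {..<m}"]) (auto dest: H(1))
  then have "card (Sigma ?H (\<lambda>E. E)) = (\<Sum>E\<in>?H. card E)" using H(2) by simp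
  also have "\<dots> = r * card ?H" using H(3) by simp
  finally have 1: "card (Sigma ?H (\<lambda>E. E)) = r * card ?H" .
  have "inj_on ?f (Sigma ?H (\<lambda>E. E))"
  proof (rule inj_onI, clarify)
    fix E x E' x' assume *: "E \<in> ?H" "x \<in> E" "E' \<in> ?H" "x' \<in> E'"
      and "E - {x} = E' - {x'}" "\<Sum>E mod m = \<Sum>E' mod m"
    then show "E = E' \<and> x = x'"
      by (intro completion_to_residue_unique[of _ m] H(1)) auto
  qed
  moreover have "?f ` Sigma ?H (\<lambda>E. E) \<subseteq> ?T"
  proof
    fix p assume "p \<in> ?f ` Sigma ?H (\<lambda>E. E)"
    then obtain E x where "p = (E - {x}, \<Sum>E mod m)" "E \<in> ?H" "x \<in> E" by auto
    then show "p \<in> ?T" using H[of E] by auto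
  qed
  moreover have "finite ?T" by simp
  ultimately have "card (Sigma ?H (\<lambda>E. E)) \<le> card ?T" by (rule card_inj_on_le)
  also have "card ?T = 2 * (m choose (r - 1))"
    by (simp add: card_cartesian_product n_subsets)
  finally show ?thesis using 1 by simp
qed

lemma card_supersets_le:
  assumes "finite X"
  shows "card {E. A \<subseteq> E \<and> E \<subseteq> X \<and> card E = r} \<le> card X ^ (r - card A)"
proof -
  let ?S = "{E. A \<subseteq> E \<and> E \<subseteq> X \<and> card E = r}"
  let ?T = "{F. F \<subseteq> X \<and> card F = r - card A}"
  have "inj_on (\<lambda>E. E - A) ?S" by (rule inj_onI) blast
  moreover have "(\<lambda>E. E - A) ` ?S \<subseteq> ?T"
    using assms by (auto intro: card_Diff_subset dest: finite_subset)
  moreover have "finite ?T" using assms by simp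
  ultimately have "card ?S \<le> card ?T" by (rule card_inj_on_le)
  also have "\<dots> = card X choose (r - card A)" using assms by (simp add: n_subsets)
  also have "\<dots> \<le> card X ^ (r - card A)"
    by (cases "r - card A \<le> card X") (auto intro: binomial_le_pow simp: binomial_eq_0)
  finally show ?thesis .
qed

lemma card_zero_and_consecutive_sets:
  assumes "r \<ge> 3"
  shows "card (zero_and_consecutive_sets r m) \<le> m ^ (r - 2)"
proof -
  have "card (zero_and_consecutive_sets r m)
      \<le> (\<Sum>y\<in>{1..<m}. card {E. {0, y, Suc y} \<subseteq> E \<and> E \<subseteq> {..<m} \<and> card E = r})"
    unfolding zero_and_consecutive_sets_def by (intro card_UN_le) simp
  also have "\<dots> \<le> (\<Sum>y\<in>{1..<m}. m ^ (r - 3))"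
  proof (rule sum_mono)
    fix y assume "y \<in> {1..<m}"
    then have "card {0, y, Suc y} = 3" by auto
    then show "card {E. {0, y, Suc y} \<subseteq> E \<and> E \<subseteq> {..<m} \<and> card E = r} \<le> m ^ (r - 3)"
      using card_supersets_le[of "{..<m}" "{0, y, Suc y}" r] by simp
  qed
  also have "\<dots> \<le> m * m ^ (r - 3)" by simp
  also have "\<dots> = m ^ (r - 2)"
  proof -
    have "r - 2 = Suc (r - 3)" using assms by simp
    then show ?thesis by simp
  qed
  finally show ?thesis .
qed

text \<open>
  The set \<open>J\<close> consists of all colours except that of \<open>0\<close>. Taking the largest elements as
  representatives ensures that the successor of a representative changes colour; the successor
  modulo \<open>m\<close> of the very last element is \<open>0\<close>, whose colour is not in \<open>J\<close>.
\<close>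
lemma rainbow_edge_exactly:
  fixes c :: "nat \<Rightarrow> 'b"
  assumes r: "r \<ge> 3" and J: "finite J" "card J = r - 1" "c 0 \<notin> J"
    and img: "c ` {..<m} = insert (c 0) J"
  shows "\<exists>E\<in>zero_or_one_sum_sets r m \<union> zero_and_consecutive_sets r m. inj_on c E"
proof -
  define a where "a j = Max {x. x < m \<and> c x = j}" for j
  have a: "a j < m" "c (a j) = j" if "j \<in> J" for j
  proof -
    have "j \<in> c ` {..<m}" using that img by simp
    then have "{x. x < m \<and> c x = j} \<noteq> {}" by auto
    then have "a j \<in> {x. x < m \<and> c x = j}" unfolding a_def by (intro Max_in) auto
    then show "a j < m" "c (a j) = j" by auto
  qed
  have a_max: "x \<le> a (c x)" if "x < m" for x
    unfolding a_def using that by (intro Max_ge) auto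
  have inj_a: "inj_on a J" by (metis a(2) inj_onI)
  have "card (c ` {..<m}) = r" using img J r by simp
  then have m: "m \<ge> 3" using card_image_le[of "{..<m}" c] r by simp
  \<comment> \<open>The edges below arise by adding a few points to the representatives of some of the colours.\<close>
  have rep: "c ` a ` I = I" "inj_on c (a ` I)" "card (a ` I) = card I" "finite (a ` I)" "a ` I \<subseteq> {..<m}"
    "\<And>x. c x \<notin> I \<Longrightarrow> x \<notin> a ` I"
    if "I \<subseteq> J" for I
  proof -
    have aI: "c (a j) = j" "a j < m" if "j \<in> I" for j using a that \<open>I \<subseteq> J\<close> by auto
    show "c ` a ` I = I" using aI by force
    show "inj_on c (a ` I)" using aI by (auto intro!: inj_onI)
    show "card (a ` I) = card I" using inj_a that by (intro card_image) (rule inj_on_subset)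
    show "finite (a ` I)" using J(1) that finite_subset by blast
    show "a ` I \<subseteq> {..<m}" using aI by auto
    show "x \<notin> a ` I" if "c x \<notin> I" for x using aI that by auto
  qed
  define s where "s = \<Sum>(a ` J)"
  define w where "w = (m - s mod m) mod m"
  have w: "w < m" using m by (simp add: w_def)
  have ws: "(w + s) mod m = 0"
  proof -
    have "(w + s) mod m = ((m - s mod m) + s mod m) mod m"
      by (simp add: w_def mod_simps)
    also have "(m - s mod m) + s mod m = m" using m by (simp add: less_imp_le)
    finally show ?thesis by simp
  qed
  show ?thesis
  proof (cases "c w = c 0")
    case True
    let ?E = "insert w (a ` J)"
    have wJ: "w \<notin> a ` J" using True J(3) by (intro rep(6)[OF subset_refl]) simp
    have "?E \<in> zero_or_one_sum_sets r m"
      using wJ rep(3-5)[OF subset_refl] w ws J r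
      by (simp add: zero_or_one_sum_sets_def s_def)
    moreover have "inj_on c ?E"
      using rep(1,2)[OF subset_refl] wJ True J(3) by simp
    ultimately show ?thesis by (intro bexI[of _ ?E] UnI1)
  next
    case False
    define j where "j = c w"
    have j: "j \<in> J" using False img w unfolding j_def by blast
    define I where "I = J - {j}"
    have I: "I \<subseteq> J" "finite I" "j \<notin> I" "J = insert j I" "card I = r - 2"
      using j J by (auto simp: I_def)
    define y where "y = Suc (a j) mod m"
    have y: "y < m" using m by (simp add: y_def)
    show ?thesis
    proof (cases "c y = c 0")
      case True
      \<comment> \<open>The point \<open>w\<close> replaces \<open>a j\<close>; the remaining sum \<open>w + s - a j\<close> is \<open>- a j\<close>, and \<open>y\<close> raises it to 1.\<close>
      let ?E = "insert y (insert w (a ` I))"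
      have wI: "w \<notin> a ` I" using I(3) by (intro rep(6)[OF I(1)]) (simp add: j_def)
      have yI: "y \<notin> a ` I" using True J(3) I(1) by (intro rep(6)[OF I(1)]) auto
      have yw: "y \<noteq> w" using True False by auto
      have "s = a j + \<Sum>(a ` I)"
        unfolding s_def I(4) using rep(4)[OF I(1)] rep(6)[OF I(1), of "a j"] a(2)[OF j] I(3) by simp
      then have "\<Sum>?E + a j = y + (w + s)"
        using wI yI yw rep(4)[OF I(1)] by simp
      then have "(\<Sum>?E + a j) mod m = (y + (w + s) mod m) mod m" by (simp add: mod_simps)
      also have "\<dots> = Suc (a j) mod m" using ws by (simp add: y_def)
      finally have "(\<Sum>?E + a j) mod m = (1 + a j) mod m" by simp
      then have "[\<Sum>?E = 1] (mod m)"
        by (simp only: cong_add_rcancel_nat flip: cong_def)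
      then have "\<Sum>?E mod m = 1 mod m" by (simp only: cong_def)
      then have "\<Sum>?E mod m \<in> {0, 1}" using m by simp
      moreover have "card ?E = r" using wI yI yw rep(3,4)[OF I(1)] I(5) r by simp
      moreover have "?E \<subseteq> {..<m}" using y w rep(5)[OF I(1)] by simp
      ultimately have "?E \<in> zero_or_one_sum_sets r m"
        unfolding zero_or_one_sum_sets_def by blast
      moreover have "inj_on c ?E"
        using rep(1,2)[OF I(1)] True J(3) I False by (auto simp: j_def)
      ultimately show ?thesis by (intro bexI[of _ ?E] UnI1)
    next
      case c_y: False
      \<comment> \<open>There was no reduction modulo \<open>m\<close>, as it would have produced \<open>0\<close>.\<close>
      have "y \<noteq> 0" using c_y by metis
      then have y_Suc: "y = Suc (a j)" using a(1)[OF j] by (auto simp: y_def mod_Suc split: if_splits)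
      define i where "i = c y"
      have "i \<noteq> j" using a_max[OF y] y_Suc i_def by auto
      then have i: "i \<in> I" using c_y img y I(4) unfolding i_def by blast
      define K where "K = I - {i}"
      have K: "K \<subseteq> J" "i \<notin> K" "j \<notin> K" "c 0 \<notin> K" "card K = r - 3"
        using I i J by (auto simp: K_def)
      let ?E = "insert 0 (insert (a j) (insert y (a ` K)))"
      have out: "0 \<notin> a ` K" "a j \<notin> a ` K" "y \<notin> a ` K"
        using K a(2)[OF j] by (auto intro!: rep(6)[OF K(1)] simp: i_def)
      have neq: "a j \<noteq> 0" "y \<noteq> 0" "a j \<noteq> y"
        using a(2)[OF j] j J(3) y_Suc by (metis, simp_all)
      have "?E \<subseteq> {..<m}" using y a(1)[OF j] rep(5)[OF K(1)] by simp
      moreover have "card ?E = r" using out neq rep(3,4)[OF K(1)] K(5) r by simp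
      ultimately have "?E \<in> zero_and_consecutive_sets r m"
        unfolding zero_and_consecutive_sets_def
        using a(1)[OF j] neq y_Suc by (intro UN_I[of "a j"]) auto
      moreover have "inj_on c ?E"
        using rep(1,2)[OF K(1)] K c_y a(2)[OF j] j J(3) \<open>i \<noteq> j\<close>
        by (auto simp: i_def)
      ultimately show ?thesis by (intro bexI[of _ ?E] UnI2)
    qed
  qed
qed

text \<open>
  Surplus colours may be merged with the colour of \<open>0\<close>, because a set that is rainbow after merging
  was rainbow before.
\<close>
lemma rainbow_edge:
  fixes c :: "nat \<Rightarrow> 'b"
  assumes r: "r \<ge> 3" and img: "card (c ` {..<m}) \<ge> r"
  shows "\<exists>E\<in>zero_or_one_sum_sets r m \<union> zero_and_consecutive_sets r m. inj_on c E"
proof -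
  have "m \<noteq> 0" using img r by (cases m) auto
  then have c0: "c 0 \<in> c ` {..<m}" by simp
  then have "r - 1 \<le> card (c ` {..<m} - {c 0})" using img by simp
  then obtain J where J: "J \<subseteq> c ` {..<m} - {c 0}" "card J = r - 1" "finite J"
    by (meson obtain_subset_with_card_n)
  define g where "g t = (if t \<in> J then t else c 0)" for t
  have g0: "g (c 0) = c 0" by (simp add: g_def)
  have "(g \<circ> c) ` {..<m} = insert ((g \<circ> c) 0) J"
  proof
    show "(g \<circ> c) ` {..<m} \<subseteq> insert ((g \<circ> c) 0) J" using g0 by (auto simp: g_def)
    have "J \<subseteq> (g \<circ> c) ` {..<m}"
    proof
      fix j assume "j \<in> J"
      then obtain x where "x < m" "j = c x" using J(1) by auto
      then show "j \<in> (g \<circ> c) ` {..<m}" using \<open>j \<in> J\<close> by (force simp: g_def)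
    qed
    then show "insert ((g \<circ> c) 0) J \<subseteq> (g \<circ> c) ` {..<m}" using \<open>m \<noteq> 0\<close> by auto
  qed
  moreover have "(g \<circ> c) 0 \<notin> J" using J(1) g0 by auto
  ultimately obtain E where E: "E \<in> zero_or_one_sum_sets r m \<union> zero_and_consecutive_sets r m"
      "inj_on (g \<circ> c) E"
    using rainbow_edge_exactly[OF r J(3) J(2), of "g \<circ> c" m] by metis
  from E(2) have "inj_on c E" by (rule inj_on_imageI2)
  with E(1) show ?thesis by (rule bexI[rotated])
qed

section \<open>From \<open>r\<close> classes to \<open>k\<close> classes\<close>

text \<open>
  The parts of the ground set used below are not initial segments, hence the transport to an
  arbitrary finite set.
\<close>
lemma exists_rainbow_hypergraph:
  fixes V :: "'a set"
  assumes r: "r \<ge> 3" and V: "finite V"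
  shows "\<exists>H. H \<subseteq> {E. E \<subseteq> V \<and> card E = r} \<and>
    real (card H) \<le> 2 / real r * real (card V choose (r - 1)) + real (card V) ^ (r - 2) \<and>
    (\<forall>c :: 'a \<Rightarrow> 'b. card (c ` V) \<ge> r \<longrightarrow> (\<exists>E\<in>H. inj_on c E))"
proof -
  define m where "m = card V"
  from ex_bij_betw_nat_finite[OF V] obtain h where "bij_betw h {0..<card V} V" ..
  then have h: "bij_betw h {..<m} V" by (simp only: m_def atLeast0LessThan)
  define H0 where "H0 = zero_or_one_sum_sets r m \<union> zero_and_consecutive_sets r m"
  have H0: "E \<subseteq> {..<m}" "card E = r" if "E \<in> H0" for E
    using that by (auto simp: H0_def zero_or_one_sum_sets_def zero_and_consecutive_sets_def)
  have finH0: "finite H0" by (rule finite_subset[of _ "Pow {..<m}"]) (auto dest: H0(1))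
  have inj_h: "inj_on h E" if "E \<in> H0" for E
    using h H0(1)[OF that] by (meson bij_betw_def inj_on_subset)
  have "(`) h ` H0 \<subseteq> {E. E \<subseteq> V \<and> card E = r}"
    using h H0 inj_h by (auto simp: card_image bij_betw_def)
  moreover have "real (card ((`) h ` H0)) \<le> 2 / real r * real (m choose (r - 1)) + real m ^ (r - 2)"
  proof -
    have "real r * real (card (zero_or_one_sum_sets r m)) \<le> 2 * real (m choose (r - 1))"
      using card_zero_or_one_sum_sets[of r m] r
      by (metis (mono_tags, lifting) le_trans of_nat_le_iff of_nat_mult of_nat_numeral one_le_numeral)
    then have "real (card (zero_or_one_sum_sets r m)) \<le> 2 / real r * real (m choose (r - 1))"
      using r by (simp add: field_simps)
    moreover have "real (card (zero_and_consecutive_sets r m)) \<le> real m ^ (r - 2)"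
      using card_zero_and_consecutive_sets[OF r, of m] by (metis of_nat_le_iff of_nat_power)
    moreover have "card ((`) h ` H0)
        \<le> card (zero_or_one_sum_sets r m) + card (zero_and_consecutive_sets r m)"
      using card_image_le[OF finH0] card_Un_le unfolding H0_def by (meson le_trans)
    ultimately show ?thesis by linarith
  qed
  moreover have "\<exists>E\<in>(`) h ` H0. inj_on c E" if "card (c ` V) \<ge> r" for c :: "'a \<Rightarrow> 'b"
  proof -
    have "(c \<circ> h) ` {..<m} = c ` V" using h by (auto simp: bij_betw_def image_comp[symmetric])
    then have "card ((c \<circ> h) ` {..<m}) \<ge> r" using that by simp
    then obtain E where "E \<in> H0" "inj_on (c \<circ> h) E"
      using rainbow_edge[OF r] unfolding H0_def by blast
    then show ?thesis by (auto intro: inj_on_imageI)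
  qed
  ultimately show ?thesis
    unfolding m_def by (intro exI[of _ "(`) h ` H0"]) simp
qed

text \<open>
  The common point \<open>v\<close> is what makes the bound sharp enough: its colour is counted only once, not
  once in each part.
\<close>
lemma some_part_sees_many_colours:
  assumes X: "X = (\<Union>i<q. V i)" "\<And>i. i < q \<Longrightarrow> v \<in> V i" "finite X" "q \<ge> 1"
    and k: "card (c ` X) > 1 + q * (r - 2)" and r: "r \<ge> 2"
  shows "\<exists>i<q. card (c ` V i) \<ge> r"
proof (rule ccontr)
  assume "\<not> ?thesis"
  then have small: "card (c ` V i) < r" if "i < q" for i using that by auto
  have rest: "card (c ` V i - {c v}) \<le> r - 2" if "i < q" for i
    using small[OF that] X(2)[OF that] r by simp
  have "c ` X \<subseteq> insert (c v) (\<Union>i<q. c ` V i - {c v})"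
    unfolding X(1) by blast
  moreover have "finite (\<Union>i<q. c ` V i - {c v})"
  proof (rule finite_subset[OF _ finite_imageI[OF X(3)]])
    show "(\<Union>i<q. c ` V i - {c v}) \<subseteq> c ` X" unfolding X(1) by blast
  qed
  ultimately have "card (c ` X) \<le> card (insert (c v) (\<Union>i<q. c ` V i - {c v}))"
    by (intro card_mono) simp_all
  also have "\<dots> \<le> 1 + card (\<Union>i<q. c ` V i - {c v})"
    by (intro card_insert_le_m1) simp_all
  also have "card (\<Union>i<q. c ` V i - {c v}) \<le> (\<Sum>i<q. card (c ` V i - {c v}))"
    by (rule card_UN_le) simp
  also have "\<dots> \<le> q * (r - 2)"
    using sum_mono[of "{..<q}", OF rest] by simp
  finally show False using k by simp
qed

lemma rainbow_imp_set_crosses: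
  assumes P: "partition_on X P" "finite P" and E: "E \<subseteq> X"
    and c: "\<And>x. x \<in> X \<Longrightarrow> c x \<in> P \<and> x \<in> c x" and inj: "inj_on c E" and k: "card E \<le> card P"
  shows "set_crosses E P"
proof -
  have "{C \<in> P. E \<inter> C \<noteq> {}} = c ` E"
  proof
    show "c ` E \<subseteq> {C \<in> P. E \<inter> C \<noteq> {}}" using c E by blast
    show "{C \<in> P. E \<inter> C \<noteq> {}} \<subseteq> c ` E"
    proof
      fix C assume "C \<in> {C \<in> P. E \<inter> C \<noteq> {}}"
      then obtain x where C: "C \<in> P" "x \<in> E" "x \<in> C" by blast
      then have "c x = C" using c[of x] E P(1) by (auto simp: partition_on_def disjoint_def)
      then show "C \<in> c ` E" using C by blast
    qed
  qed
  then show ?thesis using card_image[OF inj] k by (simp add: set_crosses_def)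
qed

lemma card_residue_class_le:
  assumes "q \<ge> 1"
  shows "card {x. x < n \<and> x mod q = i} \<le> Suc (n div q)"
proof -
  have "{x. x < n \<and> x mod q = i} \<subseteq> (\<lambda>j. j * q + i) ` {..n div q}"
  proof
    fix x assume x: "x \<in> {x. x < n \<and> x mod q = i}"
    then have "x div q \<in> {..n div q}" by (simp add: div_le_mono)
    then show "x \<in> (\<lambda>j. j * q + i) ` {..n div q}" using x by (intro rev_image_eqI) auto
  qed
  then show ?thesis using surj_card_le[of "{..n div q}"] by simp
qed

lemma choose_le_power_div_fact: "real (n choose d) \<le> real n ^ d / fact d"
proof -
  have "real ((n choose d) * fact d) \<le> real (n ^ d)"
    using binomial_fact_pow by (rule of_nat_mono)
  then show ?thesis by (simp add: pos_le_divide_eq)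
qed

text \<open>
  The parts are the residue classes modulo \<open>q\<close>, each enlarged by \<open>0\<close>. Their sizes are bounded by
  \<open>n / q + 2\<close>: one for rounding, one for the added point.
\<close>
lemma min_crossing_le:
  assumes r: "r \<ge> 3" and q: "q \<ge> 1" and k: "k = q * (r - 2) + 2" and n: "n \<ge> 1"
  shows "real (min_crossing n k r)
    \<le> real q * (2 / real r * ((real n / real q + 2) ^ (r - 1) / fact (r - 1))
                 + (real n / real q + 2) ^ (r - 2))"
    (is "_ \<le> real q * ?b")
proof -
  define V where "V i = insert 0 {x. x < n \<and> x mod q = i}" for i
  have finV: "finite (V i)" for i by (simp add: V_def)
  have cardV: "real (card (V i)) \<le> real n / real q + 2" for i
  proof -
    have "card (V i) \<le> n div q + 2"
      using card_residue_class_le[OF q, of n i] card_insert_le_m1[of "n div q + 2" "{x. x < n \<and> x mod q = i}" 0]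
      by (simp add: V_def)
    moreover have "real (n div q) \<le> real n / real q" by (rule of_nat_div_le_of_nat)
    ultimately show ?thesis by linarith
  qed
  have UV: "{..<n} = (\<Union>i<q. V i)"
  proof
    show "{..<n} \<subseteq> (\<Union>i<q. V i)"
    proof
      fix x assume "x \<in> {..<n}"
      then show "x \<in> (\<Union>i<q. V i)" using q by (intro UN_I[of "x mod q"]) (auto simp: V_def)
    qed
    show "(\<Union>i<q. V i) \<subseteq> {..<n}" using n by (auto simp: V_def)
  qed
  have V0: "0 \<in> V i" for i by (simp add: V_def)
  have V_sub: "V i \<subseteq> {..<n}" if "i < q" for i using UV that by blast
  let ?good = "\<lambda>i H. H \<subseteq> {E. E \<subseteq> V i \<and> card E = r} \<and>
    real (card H) \<le> 2 / real r * real (card (V i) choose (r - 1)) + real (card (V i)) ^ (r - 2) \<and>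
    (\<forall>c :: nat \<Rightarrow> nat set. card (c ` V i) \<ge> r \<longrightarrow> (\<exists>E\<in>H. inj_on c E))"
  have "\<forall>i. \<exists>H. ?good i H" by (intro allI exists_rainbow_hypergraph[OF r finV])
  from choice[OF this] obtain H where "\<forall>i. ?good i (H i)" ..
  note good = spec[OF this]
  note H_sub = good[THEN conjunct1] and H_card = good[THEN conjunct2, THEN conjunct1]
    and H_rainbow = good[THEN conjunct2, THEN conjunct2, rule_format]
  have H_edge: "E \<subseteq> {..<n} \<and> card E = r" if "E \<in> H i" "i < q" for E i
  proof -
    have "E \<subseteq> V i \<and> card E = r" using subsetD[OF H_sub that(1)] by simp
    then show ?thesis using V_sub[OF that(2)] by blast
  qed
  let ?H = "\<Union>i<q. H i"
  have "crosses ?H P" if kP: "k_partition k {..<n} P" for P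
  proof -
    have P: "partition_on {..<n} P" "card P = k" using kP by (auto simp: k_partition_def)
    have finP: "finite P" using finite_elements[OF _ P(1)] by simp
    have "\<forall>x\<in>{..<n}. \<exists>C. C \<in> P \<and> x \<in> C" using partition_onD1[OF P(1)] by blast
    then obtain c where c: "\<And>x. x \<in> {..<n} \<Longrightarrow> c x \<in> P \<and> x \<in> c x" by metis
    have "c ` {..<n} = P"
    proof
      show "P \<subseteq> c ` {..<n}"
      proof
        fix C assume C: "C \<in> P"
        then obtain x where x: "x \<in> C" using partition_onD3[OF P(1)] by (metis ex_in_conv)
        then have "x \<in> {..<n}" using C partition_onD1[OF P(1)] by blast
        moreover have "c x = C"
          using disjointD[OF partition_onD2[OF P(1)] _ C] c[OF \<open>x \<in> {..<n}\<close>] x by blast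
        ultimately show "C \<in> c ` {..<n}" by blast
      qed
    qed (use c in blast)
    then have many: "card (c ` {..<n}) > 1 + q * (r - 2)" using P(2) k by simp
    have "\<exists>i<q. card (c ` V i) \<ge> r"
      by (rule some_part_sees_many_colours[OF UV V0 _ q many]) (use r in simp_all)
    then obtain i where i: "i < q" "card (c ` V i) \<ge> r" by blast
    then obtain E where E: "E \<in> H i" "inj_on c E" using H_rainbow by blast
    have "E \<subseteq> {..<n}" "card E = r" using H_edge[OF E(1) i(1)] by simp_all
    moreover have "r \<le> k" using mult_le_mono1[OF q, of "r - 2"] k by linarith
    ultimately have "set_crosses E P"
      using P(2) by (intro rainbow_imp_set_crosses[OF P(1) finP _ c E(2)]) simp_all
    then show ?thesis unfolding crosses_def using E(1) i(1) by blast
  qed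
  moreover have "uniform_hypergraph r {..<n} ?H"
    unfolding uniform_hypergraph_def using H_edge by blast
  ultimately have "crossing_hypergraph k r {..<n} ?H" by (simp add: crossing_hypergraph_def)
  then have "min_crossing n k r \<le> card ?H" unfolding min_crossing_def by (intro Least_le) blast
  also have "card ?H \<le> (\<Sum>i<q. card (H i))" by (rule card_UN_le) simp
  finally have "real (min_crossing n k r) \<le> (\<Sum>i<q. real (card (H i)))"
    by (metis of_nat_le_iff of_nat_sum)
  also have "\<dots> \<le> (\<Sum>i<q. ?b)"
  proof (rule sum_mono)
    fix i
    have "real (card (V i) choose (r - 1)) \<le> real (card (V i)) ^ (r - 1) / fact (r - 1)"
      by (rule choose_le_power_div_fact)
    also have "\<dots> \<le> (real n / real q + 2) ^ (r - 1) / fact (r - 1)"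
      using cardV[of i] by (intro divide_right_mono power_mono) auto
    finally have "2 / real r * real (card (V i) choose (r - 1))
        \<le> 2 / real r * ((real n / real q + 2) ^ (r - 1) / fact (r - 1))"
      by (rule mult_left_mono) simp
    moreover have "real (card (V i)) ^ (r - 2) \<le> (real n / real q + 2) ^ (r - 2)"
      using cardV[of i] by (intro power_mono) auto
    ultimately show "real (card (H i)) \<le> ?b" using H_card[of i] by linarith
  qed
  also have "\<dots> = real q * ?b" by simp
  finally show ?thesis .
qed

section \<open>Asymptotics\<close>

lemma tendsto_choose_over_power: "(\<lambda>n. real (n choose d) / real n ^ d) \<longlonglongrightarrow> 1 / fact d"
proof -
  have "(\<lambda>n. (\<Prod>i<d. 1 - real i / real n) / fact d) \<longlonglongrightarrow> (\<Prod>i<d. 1 - 0) / fact d"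
    by (intro tendsto_intros lim_const_over_n) simp
  moreover have "\<forall>\<^sub>F n in sequentially.
      (\<Prod>i<d. 1 - real i / real n) / fact d = real (n choose d) / real n ^ d"
    using eventually_gt_at_top[of 0]
  proof eventually_elim
    case (elim n)
    have "(\<Prod>i<d. 1 - real i / real n) = (\<Prod>i<d. (real n - real i) / real n)"
      using elim by (intro prod.cong) (auto simp: field_simps)
    also have "\<dots> = (\<Prod>i<d. real n - real i) / real n ^ d" by (simp add: prod_dividef)
    finally show ?case
      by (simp add: binomial_gbinomial gbinomial_prod_rev atLeast0LessThan)
  qed
  ultimately show ?thesis by (auto dest: Lim_transform_eventually)
qed

lemma tendsto_shifted_power_over_power:
  fixes a b :: real
  shows "(\<lambda>n. (real n * a + b) ^ d / real n ^ d) \<longlonglongrightarrow> a ^ d"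
proof -
  have "(\<lambda>n. (a + b / real n) ^ d) \<longlonglongrightarrow> (a + 0) ^ d"
    by (intro tendsto_intros lim_const_over_n)
  moreover have "\<forall>\<^sub>F n in sequentially. (a + b / real n) ^ d = (real n * a + b) ^ d / real n ^ d"
    using eventually_gt_at_top[of 0]
  proof eventually_elim
    case (elim n)
    then have "a + b / real n = (real n * a + b) / real n" by (simp add: add_divide_distrib)
    then show ?case by (simp only: power_divide)
  qed
  ultimately show ?thesis by (auto dest: Lim_transform_eventually)
qed

theorem theorem14:
  fixes k r :: nat
  assumes "k \<ge> 3" and "r \<ge> 3" and "(r - 2) dvd (k - 2)"
  shows "\<exists>g :: nat \<Rightarrow> real. g \<in> o(\<lambda>n. real n ^ (r - 1)) \<and>
    (\<forall>n. n \<ge> k \<longrightarrow> n \<ge> r \<longrightarrow>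
      real (min_crossing n k r) \<le>
        2 * (real r - 2) ^ (r - 2) / (real r * (real k - 2) ^ (r - 2)) * real (n choose (r - 1))
        + g n)"
proof -
  obtain q where q: "k - 2 = (r - 2) * q" using assms(3) by blast
  have q1: "q \<ge> 1" using q assms(1) by (cases q) auto
  have k: "k = q * (r - 2) + 2" using q assms(1) by (simp add: mult.commute)
  have "real k - 2 = real (k - 2)" "real r - 2 = real (r - 2)" using assms by simp_all
  then have kr: "real k - 2 = (real r - 2) * real q" unfolding q of_nat_mult by metis
  define C where "C = 2 * (real r - 2) ^ (r - 2) / (real r * (real k - 2) ^ (r - 2))"
  have C: "C = 2 / (real r * real q ^ (r - 2))"
    unfolding C_def kr power_mult_distrib using assms(2) by simp
  define B where "B n = real q * (2 / real r * ((real n / real q + 2) ^ (r - 1) / fact (r - 1))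
                 + (real n / real q + 2) ^ (r - 2))" for n
  \<comment> \<open>Both terms of the difference have the same leading coefficient at \<open>n ^ (r - 1)\<close>.\<close>
  define g where "g n = B n - C * real (n choose (r - 1))" for n
  have r1: "r - 1 = Suc (r - 2)" using assms(2) by simp
  then have pw: "real n ^ (r - 1) = real n * real n ^ (r - 2)" for n by (simp only: power_Suc)
  have "(\<lambda>n. real q * (2 / real r * ((real n * (1 / real q) + 2) ^ (r - 1) / real n ^ (r - 1) / fact (r - 1))
          + (real n * (1 / real q) + 2) ^ (r - 2) / real n ^ (r - 2) * (1 / real n))
          - C * (real (n choose (r - 1)) / real n ^ (r - 1)))
      \<longlonglongrightarrow> real q * (2 / real r * ((1 / real q) ^ (r - 1) / fact (r - 1)) + (1 / real q) ^ (r - 2) * 0)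
          - C * (1 / fact (r - 1))"
    by (intro tendsto_intros tendsto_shifted_power_over_power tendsto_choose_over_power lim_const_over_n)
       simp_all
  also have "real q * (2 / real r * ((1 / real q) ^ (r - 1) / fact (r - 1)) + (1 / real q) ^ (r - 2) * 0)
          - C * (1 / fact (r - 1)) = 0"
    unfolding C r1 using q1 assms(2) by (simp add: field_simps)
  finally have "(\<lambda>n. g n / real n ^ (r - 1)) \<longlonglongrightarrow> 0"
    by (simp add: g_def B_def pw diff_divide_distrib add_divide_distrib distrib_left mult_ac
          del: One_nat_def)
  then have "g \<in> o(\<lambda>n. real n ^ (r - 1))"
    by (rule smalloI_tendsto) (auto intro: eventually_mono[OF eventually_gt_at_top[of 0]])
  moreover have "real (min_crossing n k r) \<le> C * real (n choose (r - 1)) + g n" if "n \<ge> k" for n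
    using min_crossing_le[OF assms(2) q1 k, of n] that assms(1) by (simp add: g_def B_def)
  ultimately show ?thesis
    unfolding C_def by (intro exI[of _ g] conjI allI impI)
qed

end
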